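(* Let $I\subset\mathbb{R}$ be a time interval, $V_{\max}>0$, and let $G:[0,V_{\max}]\to\mathbb{R}$ be a macroscopic fundamental diagram (MFD) function, i.e. a continuous concave function with $G(0)=G(V_{\max})=0$, having a unique maximizer $V^*$ over $[0,V_{\max}]$. Let $\tau^0>0$ be a constant and let $D:I\to\mathbb{R}$ be a differentiable function. Let $V:I\to[0,V_{\max}]$ (full network volume) be a differentiable function satisfying $$\dot V(t)=G\big(V(t)+\tau^0D(t)\dot V(t)\big)\big(1+\tau^0\dot D(t)\big)-G\big(V(t)\big)\qquad\forall t\in I .$$ Let $V_{\mathcal C}:I\to\mathbb{R}$ (volume partially observed with a camera set $\mathcal C$) be such that, for some constant $k_{\mathcal C}\ge 1$, $V(t)=k_{\mathcal C}V_{\mathcal C}(t)$ for all $t\in I$. Define $$G_{\mathcal C}(x)=\frac{1}{k_{\mathcal C}}\,G(k_{\mathcal C}x),\qquad x\in[0,V_{\max}/k_{\mathcal C}],$$ and let $V^*_{\mathcal C}$ denote the critical value of $G_{\mathcal C}$, i.e. its unique maximizer over $[0,V_{\max}/k_{\mathcal C}]$. Then: (1) $V_{\mathcal C}$ satisfies $$\dot V_{\mathcal C}(t)=G_{\mathcal C}\big(V_{\mathcal C}(t)+\tau^0D(t)\dot V_{\mathcal C}(t)\big)\big(1+\tau^0\dot D(t)\big)-G_{\mathcal C}\big(V_{\mathcal C}(t)\big)\qquad\forall t\in I .$$ (2) The critical values satisfy $V^*=k_{\mathcal C}V^*_{\mathcal C}$. (3) For every $t\in I$, $\dfrac{V_{\mathcal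 C}(t)}{V^*_{\mathcal C}}=\dfrac{V(t)}{V^*}$, whatever the value of $k_{\mathcal C}$.
   Context: A dot denotes the derivative with respect to time $t$. $V(t)$ models the number of vehicles in a road network at time $t$, and $V_{\mathcal C}(t)$ the number of those observed by a set $\mathcal C$ of cameras; both are treated as real-valued functions of continuous time, and the only link between them used in the statement is the proportionality $V=k_{\mathcal C}V_{\mathcal C}$ with constant $k_{\mathcal C}\ge1$. $D(t)$ is a given network-averaged congestion index and $\tau^0$ a constant (average free-flow travel time). The critical value of an MFD function is the unique point at which it attains its maximum over its domain. When a function is said to satisfy one of the displayed differential equations, it is understood that all arguments at which $G$ (respectively $G_{\mathcal C}$) is evaluated lie in its domain. *)

theory Defs
  imports "HOL-Analysis.Analysis"
begin

text \<open>Functions on \<open>[0, v]\<close> or on \<open>I\<close> are total functions on the reals; every notion below only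
  refers to their values on the respective domain.\<close>

definition maximizer_on :: "real \<Rightarrow> (real \<Rightarrow> real) \<Rightarrow> real \<Rightarrow> bool" where
  "maximizer_on v G x \<longleftrightarrow> is_arg_max G (\<lambda>y. y \<in> {0..v}) x"

definition mfd :: "real \<Rightarrow> (real \<Rightarrow> real) \<Rightarrow> bool" where
  "mfd v G \<longleftrightarrow> continuous_on {0..v} G \<and> concave_on {0..v} G \<and> G 0 = 0 \<and> G v = 0 \<and>
     (\<exists>!x. maximizer_on v G x)"

text \<open>Meaningful only when the maximizer over \<open>[0, v]\<close> exists and is unique.\<close>
definition critical_value :: "real \<Rightarrow> (real \<Rightarrow> real) \<Rightarrow> real" where
  "critical_value v G = (THE x. maximizer_on v G x)"

text \<open>The function \<open>D'\<close> is the derivative of \<open>D\<close>, and \<open>w\<close> is the derivative of \<open>V\<close> at \<open>t\<close>, taken within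
  \<open>I\<close> (hence one-sided at an endpoint belonging to \<open>I\<close>). Both arguments of \<open>G\<close> are required to lie in
  its domain \<open>[0, v]\<close>; in particular \<open>V\<close> maps \<open>I\<close> into \<open>[0, v]\<close>.\<close>
definition satisfies_dynamics ::
  "real set \<Rightarrow> real \<Rightarrow> (real \<Rightarrow> real) \<Rightarrow> real \<Rightarrow> (real \<Rightarrow> real) \<Rightarrow> (real \<Rightarrow> real) \<Rightarrow> (real \<Rightarrow> real) \<Rightarrow> bool" where
  "satisfies_dynamics I v G \<tau> D D' V \<longleftrightarrow>
     (\<forall>t\<in>I. \<exists>w. (V has_real_derivative w) (at t within I) \<and>
        V t \<in> {0..v} \<and> V t + \<tau> * D t * w \<in> {0..v} \<and>
        w = G (V t + \<tau> * D t * w) * (1 + \<tau> * D' t) - G (V t))"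

definition scaled_mfd :: "real \<Rightarrow> (real \<Rightarrow> real) \<Rightarrow> real \<Rightarrow> real" where
  "scaled_mfd k G x = 1 / k * G (k * x)"

end

theory Submission
  imports Defs
begin

text \<open>The dilation x \<mapsto> k x maps [0, v / k] onto [0, v] and conjugates
  \<open>scaled_mfd k G\<close> to G. The dynamics is homogeneous of degree one: if the volume, its
  derivative and the values of G are all divided by k, both sides of the equation are divided by k,
  while \<tau>, D and D' are untouched (\<open>satisfies_dynamics_scaled_mfd\<close>). The dilation
  also matches maximizers with maximizers (\<open>maximizer_on_scaled_mfd_iff\<close>), so critical
  values scale by k exactly as volumes do, and k cancels in their ratio. This ratio is a genuine
  quotient because the critical value is nonzero (\<open>critical_value_neq_0\<close>).\<close>

lemma scaled_mem_interval_iff: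
  fixes k v x :: real
  assumes "k > 0"
  shows "x \<in> {0..v / k} \<longleftrightarrow> k * x \<in> {0..v}"
  using assms by (auto simp: field_simps zero_le_mult_iff)

text \<open>The positive factor 1 / k preserves comparisons of values, and the dilation by k is a
  bijection between the two domains.\<close>

lemma maximizer_on_scaled_mfd_iff:
  assumes "k > 0"
  shows "maximizer_on (v / k) (scaled_mfd k G) x \<longleftrightarrow> maximizer_on v G (k * x)"
proof -
  have "(\<forall>y. y \<in> {0..v / k} \<longrightarrow> G (k * y) \<le> G (k * x)) \<longleftrightarrow> (\<forall>z. z \<in> {0..v} \<longrightarrow> G z \<le> G (k * x))"
  proof (intro iffI allI impI)
    fix z assume "\<forall>y. y \<in> {0..v / k} \<longrightarrow> G (k * y) \<le> G (k * x)" and "z \<in> {0..v}"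
    \<comment> \<open>The competitor z on [0, v] is the image of z / k.\<close>
    then show "G z \<le> G (k * x)"
      using scaled_mem_interval_iff[OF assms, of "z / k" v] assms
      by (metis nonzero_mult_div_cancel_left times_divide_eq_right less_irrefl)
  qed (use scaled_mem_interval_iff[OF assms] in blast)
  then show ?thesis
    using assms scaled_mem_interval_iff[OF assms, of x v]
    by (simp add: maximizer_on_def is_arg_max_linorder scaled_mfd_def divide_le_cancel del: atLeastAtMost_iff)
qed

lemma critical_value_eqI:
  assumes "\<exists>!x. maximizer_on v G x" and "maximizer_on v G x"
  shows "critical_value v G = x"
  unfolding critical_value_def using assms by (rule the1_equality)

lemma maximizer_on_critical_value:
  assumes "\<exists>!x. maximizer_on v G x"
  shows "maximizer_on v G (critical_value v G)"
  unfolding critical_value_def using assms by (rule theI')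

text \<open>Uniqueness is what gives the description operator in \<open>critical_value\<close> its
  meaning for the scaled function; it is transported from G along the dilation.\<close>

lemma ex1_maximizer_on_scaled_mfd:
  assumes "k > 0" and "\<exists>!x. maximizer_on v G x"
  shows "\<exists>!x. maximizer_on (v / k) (scaled_mfd k G) x"
proof (rule ex1I)
  show "maximizer_on (v / k) (scaled_mfd k G) (critical_value v G / k)"
    using assms(1) maximizer_on_critical_value[OF assms(2)]
    by (simp add: maximizer_on_scaled_mfd_iff)
  fix x assume "maximizer_on (v / k) (scaled_mfd k G) x"
  then have "critical_value v G = k * x"
    using assms by (simp add: maximizer_on_scaled_mfd_iff critical_value_eqI)
  then show "x = critical_value v G / k"
    using assms(1) by simp
qed

lemma critical_value_scaled_mfd:
  assumes "k > 0" and "\<exists>!x. maximizer_on v G x"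
  shows "critical_value v G = k * critical_value (v / k) (scaled_mfd k G)"
  using critical_value_eqI[OF assms(2)] assms(1)
    maximizer_on_critical_value[OF ex1_maximizer_on_scaled_mfd[OF assms]]
  by (simp add: maximizer_on_scaled_mfd_iff)

\<comment> \<open>If the maximizer were \<open>0\<close>, then \<open>v\<close>, where \<open>G\<close> also vanishes, would be a second one.\<close>
lemma critical_value_neq_0:
  assumes "v > 0" and "mfd v G"
  shows "critical_value v G \<noteq> 0"
proof
  have ex1: "\<exists>!x. maximizer_on v G x" and "G 0 = G v"
    using assms(2) by (auto simp: mfd_def)
  assume "critical_value v G = 0"
  then have "maximizer_on v G 0"
    using maximizer_on_critical_value[OF ex1] by simp
  moreover from this have "maximizer_on v G v"
    using assms(1) \<open>G 0 = G v\<close> by (simp add: maximizer_on_def is_arg_max_linorder)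
  ultimately show False
    using ex1 assms(1) by auto
qed

lemma satisfies_dynamics_scaled_mfd:
  assumes "k > 0" and V: "\<forall>t\<in>I. V t = k * W t"
    and dyn: "satisfies_dynamics I v G \<tau> D D' V"
  shows "satisfies_dynamics I (v / k) (scaled_mfd k G) \<tau> D D' W"
  unfolding satisfies_dynamics_def
proof
  fix t assume t: "t \<in> I"
  then obtain w where w: "(V has_real_derivative w) (at t within I)"
      "V t \<in> {0..v}" "V t + \<tau> * D t * w \<in> {0..v}"
      "w = G (V t + \<tau> * D t * w) * (1 + \<tau> * D' t) - G (V t)"
    using dyn unfolding satisfies_dynamics_def by blast
  have Vt: "V t = k * W t"
    using V t by blast
  \<comment> \<open>With w / k as the derivative of W, the dilation carries the argument for W to
    the argument for V.\<close>
  have arg: "k * (W t + \<tau> * D t * (w / k)) = V t + \<tau> * D t * w"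
    using assms(1) Vt by (simp add: field_simps)
  have "((\<lambda>s. V s / k) has_real_derivative w / k) (at t within I)"
    using w(1) by (rule DERIV_cdivide)
  \<comment> \<open>W is known to equal V / k only on I; this suffices for a derivative within I at
    a point of I.\<close>
  then have "(W has_real_derivative w / k) (at t within I)"
    unfolding has_field_derivative_def
    by (rule has_derivative_transform[rotated 2]) (use assms(1) V t in auto)
  moreover have "W t \<in> {0..v / k}" "W t + \<tau> * D t * (w / k) \<in> {0..v / k}"
    unfolding scaled_mem_interval_iff[OF assms(1)] arg using w(2,3) Vt by simp_all
  moreover have "w / k = (G (V t + \<tau> * D t * w) * (1 + \<tau> * D' t) - G (V t)) / k"
    using w(4) by simp
  then have "w / k = scaled_mfd k G (W t + \<tau> * D t * (w / k)) * (1 + \<tau> * D' t) - scaled_mfd k G (W t)"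
    unfolding scaled_mfd_def arg Vt[symmetric] by (simp add: diff_divide_distrib)
  ultimately show "\<exists>w. (W has_real_derivative w) (at t within I) \<and>
      W t \<in> {0..v / k} \<and> W t + \<tau> * D t * w \<in> {0..v / k} \<and>
      w = scaled_mfd k G (W t + \<tau> * D t * w) * (1 + \<tau> * D' t) - scaled_mfd k G (W t)"
    by blast
qed

theorem proposition4p5:
  fixes I :: "real set" and Vmax \<tau> k :: real
    and G D D' V V\<^sub>C :: "real \<Rightarrow> real"
  assumes "is_interval I"
    and "Vmax > 0"
    and "mfd Vmax G"
    and "\<tau> > 0"
    and "\<forall>t\<in>I. (D has_real_derivative D' t) (at t within I)"
    and "satisfies_dynamics I Vmax G \<tau> D D' V"
    and "k \<ge> 1"
    and "\<forall>t\<in>I. V t = k * V\<^sub>C t"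
  shows "satisfies_dynamics I (Vmax / k) (scaled_mfd k G) \<tau> D D' V\<^sub>C
    \<and> ((\<exists>!x. maximizer_on (Vmax / k) (scaled_mfd k G) x)
       \<and> critical_value Vmax G = k * critical_value (Vmax / k) (scaled_mfd k G))
    \<and> (critical_value Vmax G \<noteq> 0 \<and> critical_value (Vmax / k) (scaled_mfd k G) \<noteq> 0
       \<and> (\<forall>t\<in>I. V\<^sub>C t / critical_value (Vmax / k) (scaled_mfd k G) = V t / critical_value Vmax G))"
proof -
  have k: "k > 0"
    using assms(7) by simp
  have ex1: "\<exists>!x. maximizer_on Vmax G x"
    using assms(3) by (simp add: mfd_def)
  have crit: "critical_value Vmax G = k * critical_value (Vmax / k) (scaled_mfd k G)"
    by (rule critical_value_scaled_mfd[OF k ex1])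
  have nz: "critical_value Vmax G \<noteq> 0"
    by (rule critical_value_neq_0[OF assms(2,3)])
  have "V\<^sub>C t / critical_value (Vmax / k) (scaled_mfd k G) = V t / critical_value Vmax G"
    if "t \<in> I" for t
    unfolding crit using assms(8) that k by simp
  moreover have "critical_value (Vmax / k) (scaled_mfd k G) \<noteq> 0"
    using crit nz by auto
  ultimately show ?thesis
    using satisfies_dynamics_scaled_mfd[OF k assms(8,6)] ex1_maximizer_on_scaled_mfd[OF k ex1] crit nz
    by blast
qed

end
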